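(* Let $S\subset\mathbb{R}^d$ be a compact set and let $\aleph_n=\{X_1,\dots,X_n\}$ be an iid sample of a random vector $X$ whose distribution $P_X$ is supported on $S$. Let $S_n$ be an estimator of $S$ (based on $\aleph_n$) such that $d_\mu(S,S_n)\to 0$ almost surely. Then $$\hat{\mathcal{L}}_n(S_n)\to\mathcal{L}(S)\quad\text{in probability}.$$
   Context: $\mu_d$ is Lebesgue measure on $\mathbb{R}^d$, $\#A$ is the number of elements of a finite set $A$, and $d_\mu(A,C)=\mu_d(A\setminus C)+\mu_d(C\setminus A)$. For $x_1,\dots,x_{d+1}\in\mathbb{R}^d$, $\Delta(x_1,\dots,x_{d+1})$ is the open $d$-dimensional simplex with vertices $x_1,\dots,x_{d+1}$. The measure of non-convexity $\mathcal{L}$ of a non-empty compact set $S\subset\mathbb{R}^d$ is $$\mathcal{L}(S)=1-\mathbb{E}\left[\frac{\mu_d(\Delta(Y_1,\dots,Y_{d+1})\cap S)}{\mu_d(\Delta(Y_1,\dots,Y_{d+1}))}\right],$$ where $Y_1,\dots,Y_{d+1}$ are iid uniformly distributed on $S$. Its estimator, based on the sample $\aleph_n$ and the set estimator $S_n$, is $$\hat{\mathcal{L}}_n(S_n)=1-\frac{1}{\binom{n}{d+1}}\sum_{1\le i_1<\dots<i_{d+1}\le n}\frac{\#\mathcal{R}(X_{i_1},\dots,X_{i_{d+1}})\,\mu_d(S_n)}{(n-d-1)\,\mu_d(\Delta(X_{i_1},\dots,X_{i_{d+1}}))},$$ where $$\mathcal{R}(X_{i_1},\dots,X_{i_{d+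1}})=\big[\aleph_n\setminus\{X_{i_1},\dots,X_{i_{d+1}}\}\big]\cap\Delta(X_{i_1},\dots,X_{i_{d+1}}).$$
   Formalization: X is taken to be uniformly distributed on S rather than merely supported on S; otherwise the claim fails (d=1, S=S_n=[0,1], density 2x gives limit -1/3 while L(S)=0). S_n is assumed measurable, with its measure a random variable. *)

theory Defs
  imports "HOL-Probability.Probability"
begin

text \<open>
  The dimension d is \<open>DIM('a)\<close> and Lebesgue measure is \<open>lebesgue\<close>, the completion of \<open>lborel\<close>.
  The uniform distribution on \<open>S\<close> is \<open>uniform_measure lborel S\<close>, a measure on the Borel sets.
\<close>

text \<open>
  The simplex depends only on the set \<open>V\<close> of its vertices. For \<open>d + 1\<close> affinely dependent
  points the interior is empty; this is a null event for points drawn from a density.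
\<close>

definition open_simplex :: "'a::euclidean_space set \<Rightarrow> 'a set" where
  "open_simplex V = interior (convex hull V)"

text \<open>
  The values lie in \<open>ennreal\<close>: the real-valued \<open>measure\<close> would send a difference of infinite
  measure to 0.
\<close>

definition d_mu :: "'a::euclidean_space set \<Rightarrow> 'a set \<Rightarrow> ennreal" where
  "d_mu A C = emeasure lebesgue (A - C) + emeasure lebesgue (C - A)"

text \<open>
  The expectation over iid uniform points is the integral against their joint law; the \<open>d + 1\<close>
  points are indexed by \<open>{..d}\<close>.
\<close>

definition nonconvexity :: "'a::euclidean_space set \<Rightarrow> real" where
  "nonconvexity S = 1 -
     (\<integral>y. measure lebesgue (open_simplex (y ` {..DIM('a)}) \<inter> S)
            / measure lebesgue (open_simplex (y ` {..DIM('a)}))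
        \<partial>(\<Pi>\<^sub>M i\<in>{..DIM('a)}. uniform_measure lborel S))"

text \<open>
  The sample of size \<open>n\<close> is \<open>x 0, \<dots>, x (n - 1)\<close>. An increasing tuple of indices is represented
  by the set \<open>I\<close> of its entries.
\<close>

definition other_points_in_simplex ::
    "nat \<Rightarrow> (nat \<Rightarrow> 'a::euclidean_space) \<Rightarrow> nat set \<Rightarrow> 'a set" where
  "other_points_in_simplex n x I = (x ` {..<n} - x ` I) \<inter> open_simplex (x ` I)"

definition nonconvexity_estimator ::
    "nat \<Rightarrow> (nat \<Rightarrow> 'a::euclidean_space) \<Rightarrow> 'a set \<Rightarrow> real" where
  "nonconvexity_estimator n x A = 1 -
     1 / real (n choose (DIM('a) + 1)) *
     (\<Sum>I | I \<subseteq> {..<n} \<and> card I = DIM('a) + 1.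
        real (card (other_points_in_simplex n x I)) * measure lebesgue A
        / ((real n - real DIM('a) - 1) * measure lebesgue (open_simplex (x ` I))))"

text \<open>
  Measurability is part of the definition because \<open>measure\<close> assigns 0 to non-measurable sets.
\<close>

definition converges_in_probability ::
    "'m measure \<Rightarrow> (nat \<Rightarrow> 'm \<Rightarrow> real) \<Rightarrow> real \<Rightarrow> bool" where
  "converges_in_probability M Z c \<longleftrightarrow>
     (\<forall>n. Z n \<in> borel_measurable M) \<and>
     (\<forall>\<epsilon>>0. (\<lambda>n. measure M {\<omega> \<in> space M. \<bar>Z n \<omega> - c\<bar> > \<epsilon>}) \<longlonglongrightarrow> 0)"

end

theory Submission
  imports Defs
begin

text \<open>
  Almost surely the sample points are distinct, and then the estimator is \<open>1 - \<mu>(S\<^sub>n) U\<^sub>n\<close>, where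
  \<open>U\<^sub>n\<close> averages the kernel \<open>h = 1[X\<^sub>j \<in> \<Delta>(X\<^sub>I)] / \<mu>(\<Delta>(X\<^sub>I))\<close> over all pairs of a \<open>(d+1)\<close>-subset
  \<open>I\<close> and an index \<open>j \<notin> I\<close>. Integrating out \<open>X\<^sub>j\<close> gives \<open>\<mu>(\<Delta>(X\<^sub>I) \<inter> S) / (\<mu>(S) \<mu>(\<Delta>(X\<^sub>I)))\<close>, so that
  \<open>h\<close> is integrable with mean \<open>\<theta> = (1 - \<L>(S)) / \<mu>(S)\<close>. The kernel need not be square integrable
  (for \<open>d = 1\<close> its second moment is of the order of the mean of \<open>1/|X\<^sub>1 - X\<^sub>2|\<close>), so \<open>U\<^sub>n \<rightarrow> \<theta>\<close> is proved in \<open>L\<^sup>1\<close> by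
  truncating \<open>h\<close>. The average of the truncated kernel has variance \<open>O(1/n)\<close>, because two pairs
  without a common index are independent and only a proportion \<open>O(1/n)\<close> of all pairs meets a given one.
\<close>

subsection \<open>Averages over overlapping tuples of an iid sequence\<close>

text \<open>The whole sequence has the infinite product of \<open>P\<close> as its law, and an
  injective selection of coordinates pushes a product measure forward to a product measure.\<close>

lemma (in prob_space) distr_iid_reindex:
  assumes ind: "indep_vars (\<lambda>_. N) X UNIV"
    and law: "\<And>i. distr M N (X i) = P"
    and e: "inj_on e J"
  shows "distr M (\<Pi>\<^sub>M j\<in>J. N) (\<lambda>\<omega>. \<lambda>j\<in>J. X (e j) \<omega>) = (\<Pi>\<^sub>M j\<in>J. P)"
proof -
  have rv [measurable]: "X i \<in> measurable M N" for i
    using ind by (auto simp: indep_vars_def)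
  have P: "prob_space P"
    using prob_space_distr[OF rv, of undefined] law by simp
  have [measurable_cong]: "sets P = sets N"
    using law[of undefined, symmetric] by simp
  have "distr M (\<Pi>\<^sub>M j\<in>J. N) (\<lambda>\<omega>. \<lambda>j\<in>J. X (e j) \<omega>)
      = distr M (\<Pi>\<^sub>M j\<in>J. P) ((\<lambda>x. \<lambda>j\<in>J. x (e j)) \<circ> (\<lambda>\<omega>. \<lambda>i\<in>UNIV. X i \<omega>))"
    by (intro distr_cong) (auto intro!: sets_PiM_cong simp: \<open>sets P = sets N\<close>)
  also have "\<dots> = distr (distr M (\<Pi>\<^sub>M i\<in>UNIV. N) (\<lambda>\<omega>. \<lambda>i\<in>UNIV. X i \<omega>))
                    (\<Pi>\<^sub>M j\<in>J. P) (\<lambda>x. \<lambda>j\<in>J. x (e j))"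
    by (subst distr_distr) (auto intro!: measurable_restrict)
  also have "distr M (\<Pi>\<^sub>M i\<in>UNIV. N) (\<lambda>\<omega>. \<lambda>i\<in>UNIV. X i \<omega>) = (\<Pi>\<^sub>M i\<in>UNIV. P)"
    using indep_vars_iff_distr_eq_PiM[of UNIV X "\<lambda>_. N"] ind law by simp
  also have "distr (\<Pi>\<^sub>M i\<in>UNIV. P) (\<Pi>\<^sub>M j\<in>J. P) (\<lambda>x. \<lambda>j\<in>J. x (e j)) = (\<Pi>\<^sub>M j\<in>J. P)"
    using distr_PiM_reindex[of UNIV "\<lambda>_. P" e J] P e by simp
  finally show ?thesis .
qed

lemma (in prob_space) integral_iid_reindex:
  fixes h :: "('j \<Rightarrow> 'c) \<Rightarrow> real"
  assumes ind: "indep_vars (\<lambda>_. N) X UNIV"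
    and law: "\<And>i. distr M N (X i) = P"
    and e: "inj_on e J"
    and h: "h \<in> borel_measurable (\<Pi>\<^sub>M j\<in>J. N)"
  shows "(\<integral>\<omega>. h (\<lambda>j\<in>J. X (e j) \<omega>) \<partial>M) = (\<integral>y. h y \<partial>(\<Pi>\<^sub>M j\<in>J. P))"
    and "integrable M (\<lambda>\<omega>. h (\<lambda>j\<in>J. X (e j) \<omega>)) \<longleftrightarrow> integrable (\<Pi>\<^sub>M j\<in>J. P) h"
proof -
  have [measurable]: "X i \<in> measurable M N" for i
    using ind by (auto simp: indep_vars_def)
  have *: "(\<lambda>\<omega>. \<lambda>j\<in>J. X (e j) \<omega>) \<in> measurable M (\<Pi>\<^sub>M j\<in>J. N)"
    by (auto intro!: measurable_restrict)
  show "(\<integral>\<omega>. h (\<lambda>j\<in>J. X (e j) \<omega>) \<partial>M) = (\<integral>y. h y \<partial>(\<Pi>\<^sub>M j\<in>J. P))"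
    unfolding distr_iid_reindex[OF ind law e, symmetric] by (rule integral_distr[OF * h, symmetric])
  show "integrable M (\<lambda>\<omega>. h (\<lambda>j\<in>J. X (e j) \<omega>)) \<longleftrightarrow> integrable (\<Pi>\<^sub>M j\<in>J. P) h"
    unfolding distr_iid_reindex[OF ind law e, symmetric] by (rule integrable_distr_eq[OF * h, symmetric])
qed

text \<open>The square expands into covariances over pairs from \<open>T\<close>. A pair with
  disjoint index sets contributes 0 by independence, any other pair at most
  \<open>K\<^sup>2\<close>, and \<open>overlap\<close> leaves at most \<open>c * card T\<close> of
  the latter in each row.\<close>

lemma (in prob_space) iid_average_L2_bound:
  fixes h :: "('j \<Rightarrow> 'c) \<Rightarrow> real" and e :: "'t \<Rightarrow> 'j \<Rightarrow> 'i"
  assumes ind: "indep_vars (\<lambda>_. N) X UNIV"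
    and law: "\<And>i. distr M N (X i) = P"
    and h [measurable]: "h \<in> borel_measurable (\<Pi>\<^sub>M j\<in>J. N)"
    and bound: "\<And>y. \<bar>h y\<bar> \<le> K"
    and T: "finite T" "T \<noteq> {}"
    and e: "\<And>t. t \<in> T \<Longrightarrow> inj_on (e t) J"
    and overlap: "\<And>t. t \<in> T \<Longrightarrow>
      real (card {u \<in> T. e t ` J \<inter> e u ` J \<noteq> {}}) \<le> c * real (card T)"
  shows "(\<integral>\<omega>. ((\<Sum>t\<in>T. h (\<lambda>j\<in>J. X (e t j) \<omega>)) / card T - (\<integral>y. h y \<partial>(\<Pi>\<^sub>M j\<in>J. P)))\<^sup>2 \<partial>M)
    \<le> c * K\<^sup>2"
proof -
  have [measurable]: "X i \<in> measurable M N" for i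
    using ind by (auto simp: indep_vars_def)
  define Y where "Y t \<omega> = h (\<lambda>j\<in>J. X (e t j) \<omega>)" for t \<omega>
  define \<theta> where "\<theta> = (\<integral>y. h y \<partial>(\<Pi>\<^sub>M j\<in>J. P))"
  define n where "n = card T"
  have n: "n > 0"
    using T by (auto simp: n_def card_gt_0_iff)
  have [measurable]: "Y t \<in> borel_measurable M" for t
  proof -
    have "(\<lambda>\<omega>. \<lambda>j\<in>J. X (e t j) \<omega>) \<in> measurable M (\<Pi>\<^sub>M j\<in>J. N)"
      by (auto intro!: measurable_restrict)
    then show ?thesis
      unfolding Y_def by measurable
  qed
  have Y_bound: "\<bar>Y t \<omega>\<bar> \<le> K" for t \<omega>
    unfolding Y_def by (rule bound)
  then have K: "0 \<le> K"
    by (meson abs_ge_zero order_trans)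
  have Y_int [simp]: "integrable M (Y t)" for t
    by (rule integrable_const_bound[where B = K]) (auto simp: Y_bound)
  have prod_bound: "\<bar>Y t \<omega> * Y u \<omega>\<bar> \<le> K\<^sup>2" for t u \<omega>
    unfolding abs_mult power2_eq_square by (intro mult_mono Y_bound K) auto
  have YY_int [simp]: "integrable M (\<lambda>\<omega>. Y t \<omega> * Y u \<omega>)" for t u
    by (rule integrable_const_bound[where B = "K\<^sup>2"]) (auto simp: prod_bound)
  have mean: "(\<integral>\<omega>. Y t \<omega> \<partial>M) = \<theta>" if "t \<in> T" for t
    unfolding Y_def \<theta>_def by (rule integral_iid_reindex(1)[OF ind law e[OF that] h])
  have cov: "(\<integral>\<omega>. (Y t \<omega> - \<theta>) * (Y u \<omega> - \<theta>) \<partial>M) = (\<integral>\<omega>. Y t \<omega> * Y u \<omega> \<partial>M) - \<theta>\<^sup>2"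
    if "t \<in> T" "u \<in> T" for t u
  proof -
    have "(\<integral>\<omega>. (Y t \<omega> - \<theta>) * (Y u \<omega> - \<theta>) \<partial>M)
        = (\<integral>\<omega>. Y t \<omega> * Y u \<omega> - \<theta> * Y t \<omega> - \<theta> * Y u \<omega> + \<theta>\<^sup>2 \<partial>M)"
      by (intro Bochner_Integration.integral_cong) (auto simp: algebra_simps power2_eq_square)
    also have "\<dots> = (\<integral>\<omega>. Y t \<omega> * Y u \<omega> \<partial>M) - \<theta>\<^sup>2"
      using that by (simp add: mean prob_space power2_eq_square)
    finally show ?thesis .
  qed
  have cov_le: "(\<integral>\<omega>. (Y t \<omega> - \<theta>) * (Y u \<omega> - \<theta>) \<partial>M)
      \<le> (if e t ` J \<inter> e u ` J \<noteq> {} then K\<^sup>2 else 0)" if tu: "t \<in> T" "u \<in> T" for t u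
  proof (cases "e t ` J \<inter> e u ` J = {}")
    case True
    let ?R = "\<lambda>A \<omega>. \<lambda>i\<in>A. X i \<omega>" and ?f = "\<lambda>t x. h (\<lambda>j\<in>J. x (e t j))"
    have f: "?f t \<in> borel_measurable (\<Pi>\<^sub>M i\<in>e t ` J. N)" for t
    proof -
      have "(\<lambda>x. \<lambda>j\<in>J. x (e t j)) \<in> measurable (\<Pi>\<^sub>M i\<in>e t ` J. N) (\<Pi>\<^sub>M j\<in>J. N)"
        by (intro measurable_restrict measurable_component_singleton) auto
      then show ?thesis
        by measurable
    qed
    \<comment> \<open>Each of \<open>Y t\<close> and \<open>Y u\<close> factors through the
      restriction of the sequence to its own block of indices, and disjoint blocks of an independent
      family are independent.\<close>
    have "indep_var borel (?f t \<circ> ?R (e t ` J)) borel (?f u \<circ> ?R (e u ` J))"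
      using indep_var_compose[OF indep_var_restrict[OF ind True] f f] by simp
    also have "?f t \<circ> ?R (e t ` J) = Y t"
      unfolding Y_def comp_def by (intro ext arg_cong[where f = h]) auto
    also have "?f u \<circ> ?R (e u ` J) = Y u"
      unfolding Y_def comp_def by (intro ext arg_cong[where f = h]) auto
    finally have "(\<integral>\<omega>. Y t \<omega> * Y u \<omega> \<partial>M) = \<theta> * \<theta>"
      using tu by (simp add: indep_var_lebesgue_integral mean)
    then show ?thesis
      using cov[OF tu] True by (simp add: power2_eq_square)
  next
    case False
    \<comment> \<open>The covariance is the mixed moment minus \<open>\<theta>\<^sup>2\<close>;
      dropping the square only enlarges it.\<close>
    have "(\<integral>\<omega>. Y t \<omega> * Y u \<omega> \<partial>M) \<le> (\<integral>\<omega>. K\<^sup>2 \<partial>M)"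
      by (intro integral_mono) (auto intro: order_trans[OF abs_ge_self prod_bound])
    then show ?thesis
      using cov[OF tu] False by (simp add: prob_space) (smt (verit) zero_le_power2)
  qed
  have int: "integrable M (\<lambda>\<omega>. (Y t \<omega> - \<theta>) * (Y u \<omega> - \<theta>))" for t u
  proof -
    have "(\<lambda>\<omega>. (Y t \<omega> - \<theta>) * (Y u \<omega> - \<theta>))
        = (\<lambda>\<omega>. Y t \<omega> * Y u \<omega> - \<theta> * Y t \<omega> - \<theta> * Y u \<omega> + \<theta>\<^sup>2)"
      by (auto simp: algebra_simps power2_eq_square)
    then show ?thesis
      by simp
  qed
  have "((\<Sum>t\<in>T. Y t \<omega>) / n - \<theta>)\<^sup>2 = (\<Sum>t\<in>T. \<Sum>u\<in>T. (Y t \<omega> - \<theta>) * (Y u \<omega> - \<theta>)) / n\<^sup>2" for \<omega>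
  proof -
    have "(\<Sum>t\<in>T. Y t \<omega>) / n - \<theta> = (\<Sum>t\<in>T. Y t \<omega> - \<theta>) / n"
      using n by (simp add: sum_subtractf n_def[symmetric] field_simps)
    then show ?thesis
      by (simp add: power_divide power2_eq_square sum_product)
  qed
  then have "(\<integral>\<omega>. ((\<Sum>t\<in>T. Y t \<omega>) / n - \<theta>)\<^sup>2 \<partial>M)
      = (\<Sum>t\<in>T. \<Sum>u\<in>T. (\<integral>\<omega>. (Y t \<omega> - \<theta>) * (Y u \<omega> - \<theta>) \<partial>M)) / n\<^sup>2"
    by (simp add: int integrable_sum Bochner_Integration.integral_sum)
  also have "\<dots> \<le> (\<Sum>t\<in>T. \<Sum>u\<in>T. if e t ` J \<inter> e u ` J \<noteq> {} then K\<^sup>2 else 0) / n\<^sup>2"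
    by (intro divide_right_mono sum_mono cov_le) auto
  also have "\<dots> = (\<Sum>t\<in>T. real (card {u \<in> T. e t ` J \<inter> e u ` J \<noteq> {}}) * K\<^sup>2) / n\<^sup>2"
    using T by (simp add: sum.If_cases Int_def)
  also have "\<dots> \<le> (\<Sum>t\<in>T. c * n * K\<^sup>2) / n\<^sup>2"
    unfolding n_def by (intro divide_right_mono sum_mono mult_right_mono overlap) auto
  also have "\<dots> = c * K\<^sup>2"
    using n by (simp add: n_def[symmetric] power2_eq_square field_simps)
  finally show ?thesis
    by (simp add: Y_def \<theta>_def n_def)
qed

text \<open>Once \<open>\<bar>z\<bar>\<close> exceeds \<open>\<eta>\<close>, the quadratic term
  alone dominates it. This converts a second moment into a bound on the first absolute moment, with
  \<open>\<eta>\<close> free to be chosen.\<close>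

lemma abs_le_add_square_divide:
  fixes z \<eta> :: real
  assumes "\<eta> > 0"
  shows "\<bar>z\<bar> \<le> \<eta> + z\<^sup>2 / \<eta>"
proof (cases "\<bar>z\<bar> \<le> \<eta>")
  case False
  then have "\<bar>z\<bar> * \<eta> \<le> \<bar>z\<bar> * \<bar>z\<bar>"
    by (intro mult_left_mono) auto
  then have "\<bar>z\<bar> \<le> z\<^sup>2 / \<eta>"
    using assms by (simp add: field_simps power2_eq_square)
  then show ?thesis
    using assms by linarith
qed (use assms in \<open>simp add: add_increasing2\<close>)

text \<open>The truncation \<open>g\<close> of \<open>h\<close> at level \<open>K\<close> is
  bounded, so the second moment bound applies to its average and yields the first two terms. The
  remainder \<open>h - g\<close> is paid for twice, once in the averages and once in the means,
  hence the factor 2.\<close>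

lemma (in prob_space) iid_average_L1_bound:
  fixes h :: "('j \<Rightarrow> 'c) \<Rightarrow> real" and e :: "'t \<Rightarrow> 'j \<Rightarrow> 'i"
  assumes ind: "indep_vars (\<lambda>_. N) X UNIV"
    and law: "\<And>i. distr M N (X i) = P"
    and h: "integrable (\<Pi>\<^sub>M j\<in>J. P) h"
    and \<eta>: "\<eta> > 0" and K: "K \<ge> 0"
    and T: "finite T" "T \<noteq> {}"
    and e: "\<And>t. t \<in> T \<Longrightarrow> inj_on (e t) J"
    and overlap: "\<And>t. t \<in> T \<Longrightarrow>
      real (card {u \<in> T. e t ` J \<inter> e u ` J \<noteq> {}}) \<le> c * real (card T)"
  shows "(\<integral>\<omega>. \<bar>(\<Sum>t\<in>T. h (\<lambda>j\<in>J. X (e t j) \<omega>)) / card T - (\<integral>y. h y \<partial>(\<Pi>\<^sub>M j\<in>J. P))\<bar> \<partial>M)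
    \<le> \<eta> + c * K\<^sup>2 / \<eta> + 2 * (\<integral>y. \<bar>h y - max (- K) (min K (h y))\<bar> \<partial>(\<Pi>\<^sub>M j\<in>J. P))"
proof -
  have rv: "X i \<in> measurable M N" for i
    using ind by (auto simp: indep_vars_def)
  have [measurable_cong]: "sets P = sets N"
    using law[of undefined, symmetric] by simp
  have sets_eq: "sets (\<Pi>\<^sub>M j\<in>J. P) = sets (\<Pi>\<^sub>M j\<in>J. N)"
    by (intro sets_PiM_cong) (auto simp: \<open>sets P = sets N\<close>)
  interpret J: prob_space "\<Pi>\<^sub>M j\<in>J. P"
    using prob_space_distr[OF rv, of undefined] law by (intro prob_space_PiM) simp
  have h_meas [measurable]: "h \<in> borel_measurable (\<Pi>\<^sub>M j\<in>J. N)"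
    using borel_measurable_integrable[OF h] measurable_cong_sets[OF sets_eq refl] by blast
  define g where "g y = max (- K) (min K (h y))" for y
  have g_bound: "\<bar>g y\<bar> \<le> K" for y
    using K by (auto simp: g_def)
  have g_meas [measurable]: "g \<in> borel_measurable (\<Pi>\<^sub>M j\<in>J. N)"
    unfolding g_def by measurable
  have g_meas' [measurable]: "g \<in> borel_measurable (\<Pi>\<^sub>M j\<in>J. P)"
    using g_meas measurable_cong_sets[OF sets_eq refl] by blast
  have g: "integrable (\<Pi>\<^sub>M j\<in>J. P) g"
    by (rule J.integrable_const_bound[where B = K]) (auto simp: g_bound)
  let ?R = "\<lambda>t \<omega>. \<lambda>j\<in>J. X (e t j) \<omega>"
  define a b where "a = (\<integral>y. h y \<partial>(\<Pi>\<^sub>M j\<in>J. P))" and "b = (\<integral>y. g y \<partial>(\<Pi>\<^sub>M j\<in>J. P))"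
  define r where "r = (\<integral>y. \<bar>h y - g y\<bar> \<partial>(\<Pi>\<^sub>M j\<in>J. P))"
  have n: "real (card T) > 0"
    using T by (auto simp: card_gt_0_iff)
  have int_h: "integrable M (\<lambda>\<omega>. h (?R t \<omega>))" if "t \<in> T" for t
    using integral_iid_reindex(2)[OF ind law e[OF that] h_meas] h by simp
  have int_g: "integrable M (\<lambda>\<omega>. g (?R t \<omega>))" if "t \<in> T" for t
    using integral_iid_reindex(2)[OF ind law e[OF that] g_meas] g by simp
  have diff: "(\<integral>\<omega>. \<bar>h (?R t \<omega>) - g (?R t \<omega>)\<bar> \<partial>M) = r" if "t \<in> T" for t
    unfolding r_def by (rule integral_iid_reindex(1)[OF ind law e[OF that]]) measurable
  define A B where "A \<omega> = (\<Sum>t\<in>T. h (?R t \<omega>)) / card T" and "B \<omega> = (\<Sum>t\<in>T. g (?R t \<omega>)) / card T" for \<omega>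
  have A: "integrable M A" and B: "integrable M B"
    unfolding A_def B_def
    by (intro integrable_divide Bochner_Integration.integrable_sum int_h int_g; assumption)+
  have "integrable M (\<lambda>\<omega>. (B \<omega> - b)\<^sup>2)"
  proof (rule integrable_const_bound[where B = "(K + \<bar>b\<bar>)\<^sup>2"])
    have "\<bar>B \<omega>\<bar> \<le> K" for \<omega>
    proof -
      have "\<bar>\<Sum>t\<in>T. g (?R t \<omega>)\<bar> \<le> (\<Sum>t\<in>T. K)"
        by (intro order_trans[OF sum_abs] sum_mono g_bound)
      then show ?thesis
        using n by (simp add: B_def field_simps)
    qed
    then have "\<bar>B \<omega> - b\<bar> \<le> \<bar>K + \<bar>b\<bar>\<bar>" for \<omega>
      using abs_triangle_ineq4[of "B \<omega>" b] by (smt (verit, best))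
    then show "AE \<omega> in M. norm ((B \<omega> - b)\<^sup>2) \<le> (K + \<bar>b\<bar>)\<^sup>2"
      by (simp add: abs_le_square_iff)
  qed (use B in measurable)
  note int_sq = this
  have "(\<integral>\<omega>. \<bar>B \<omega> - b\<bar> \<partial>M) \<le> (\<integral>\<omega>. \<eta> + (B \<omega> - b)\<^sup>2 / \<eta> \<partial>M)"
    using B int_sq by (intro integral_mono abs_le_add_square_divide \<eta>) auto
  also have "\<dots> = \<eta> + (\<integral>\<omega>. (B \<omega> - b)\<^sup>2 \<partial>M) / \<eta>"
    using int_sq by (simp add: prob_space)
  also have "\<dots> \<le> \<eta> + c * K\<^sup>2 / \<eta>"
    using iid_average_L2_bound[OF ind law g_meas g_bound T e overlap] \<eta>
    by (auto simp: B_def b_def intro!: divide_right_mono)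
  finally have 1: "(\<integral>\<omega>. \<bar>B \<omega> - b\<bar> \<partial>M) \<le> \<eta> + c * K\<^sup>2 / \<eta>" .
  have "(\<integral>\<omega>. \<bar>A \<omega> - B \<omega>\<bar> \<partial>M) \<le> (\<integral>\<omega>. (\<Sum>t\<in>T. \<bar>h (?R t \<omega>) - g (?R t \<omega>)\<bar>) / card T \<partial>M)"
  proof (rule integral_mono)
    show "\<bar>A \<omega> - B \<omega>\<bar> \<le> (\<Sum>t\<in>T. \<bar>h (?R t \<omega>) - g (?R t \<omega>)\<bar>) / card T" for \<omega>
      by (simp add: A_def B_def diff_divide_distrib[symmetric] sum_subtractf[symmetric] divide_right_mono)
  qed (use A B int_h int_g in \<open>auto intro!: Bochner_Integration.integrable_sum\<close>)
  also have "\<dots> = (\<Sum>t\<in>T. (\<integral>\<omega>. \<bar>h (?R t \<omega>) - g (?R t \<omega>)\<bar> \<partial>M)) / card T"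
    using int_h int_g by (simp add: Bochner_Integration.integral_sum)
  also have "\<dots> = r"
    using n by (simp add: diff)
  finally have 2: "(\<integral>\<omega>. \<bar>A \<omega> - B \<omega>\<bar> \<partial>M) \<le> r" .
  have "b - a = (\<integral>y. g y - h y \<partial>(\<Pi>\<^sub>M j\<in>J. P))"
    using g h by (simp add: a_def b_def)
  also have "\<bar>\<dots>\<bar> \<le> (\<integral>y. \<bar>g y - h y\<bar> \<partial>(\<Pi>\<^sub>M j\<in>J. P))"
    by (rule integral_abs_bound)
  finally have 3: "\<bar>b - a\<bar> \<le> r"
    by (simp add: r_def abs_minus_commute)
  have "(\<integral>\<omega>. \<bar>A \<omega> - a\<bar> \<partial>M) \<le> (\<integral>\<omega>. \<bar>A \<omega> - B \<omega>\<bar> + \<bar>B \<omega> - b\<bar> + \<bar>b - a\<bar> \<partial>M)"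
    using A B by (intro integral_mono) auto
  also have "\<dots> = (\<integral>\<omega>. \<bar>A \<omega> - B \<omega>\<bar> \<partial>M) + (\<integral>\<omega>. \<bar>B \<omega> - b\<bar> \<partial>M) + \<bar>b - a\<bar>"
    using A B by (simp add: prob_space)
  finally show "(\<integral>\<omega>. \<bar>(\<Sum>t\<in>T. h (?R t \<omega>)) / card T - (\<integral>y. h y \<partial>(\<Pi>\<^sub>M j\<in>J. P))\<bar> \<partial>M)
    \<le> \<eta> + c * K\<^sup>2 / \<eta> + 2 * (\<integral>y. \<bar>h y - max (- K) (min K (h y))\<bar> \<partial>(\<Pi>\<^sub>M j\<in>J. P))"
    using 1 2 3 unfolding A_def a_def r_def g_def by linarith
qed

text \<open>Dominated convergence: at each \<open>y\<close> the error vanishes once \<open>k\<close>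
  has passed \<open>\<bar>h y\<bar>\<close>, and it never exceeds
  \<open>\<bar>h y\<bar>\<close>.\<close>

lemma tendsto_integral_truncation:
  fixes h :: "'b \<Rightarrow> real"
  assumes h: "integrable M h"
  shows "(\<lambda>k. \<integral>y. \<bar>h y - max (- real k) (min (real k) (h y))\<bar> \<partial>M) \<longlonglongrightarrow> 0"
proof -
  have [measurable]: "h \<in> borel_measurable M"
    using h by simp
  have "(\<lambda>k. \<integral>y. \<bar>h y - max (- real k) (min (real k) (h y))\<bar> \<partial>M) \<longlonglongrightarrow> (\<integral>y. 0 \<partial>M)"
  proof (rule integral_dominated_convergence[where w = "\<lambda>y. \<bar>h y\<bar>"])
    have "\<forall>\<^sub>F k in sequentially. \<bar>h y - max (- real k) (min (real k) (h y))\<bar> = 0" for y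
    proof -
      obtain m :: nat where "\<bar>h y\<bar> \<le> real m"
        using real_arch_simple by blast
      then show ?thesis
        by (intro eventually_sequentiallyI[of m]) auto
    qed
    then show "AE y in M. (\<lambda>k. \<bar>h y - max (- real k) (min (real k) (h y))\<bar>) \<longlonglongrightarrow> 0"
      by (intro AE_I2 tendsto_eventually) auto
    show "AE y in M. norm \<bar>h y - max (- real k) (min (real k) (h y))\<bar> \<le> \<bar>h y\<bar>" for k
      by (intro AE_I2) auto
  qed (use h in auto)
  then show ?thesis
    by simp
qed

text \<open>A weak law of large numbers of U-statistic type: \<open>c n\<close> bounds the
  proportion of tuples that meet a given one, so for large \<open>n\<close> most pairs of terms are
  independent.\<close>

proposition (in prob_space) iid_averages_tendsto_L1:
  fixes h :: "('j \<Rightarrow> 'c) \<Rightarrow> real" and e :: "'t \<Rightarrow> 'j \<Rightarrow> 'i" and T :: "nat \<Rightarrow> 't set"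
  assumes ind: "indep_vars (\<lambda>_. N) X UNIV"
    and law: "\<And>i. distr M N (X i) = P"
    and h: "integrable (\<Pi>\<^sub>M j\<in>J. P) h"
    and T: "\<And>n. finite (T n)" "\<forall>\<^sub>F n in sequentially. T n \<noteq> {}"
    and e: "\<And>n t. t \<in> T n \<Longrightarrow> inj_on (e t) J"
    and overlap: "\<And>n t. t \<in> T n \<Longrightarrow>
      real (card {u \<in> T n. e t ` J \<inter> e u ` J \<noteq> {}}) \<le> c n * real (card (T n))"
    and c: "c \<longlonglongrightarrow> 0"
  shows "(\<lambda>n. \<integral>\<omega>. \<bar>(\<Sum>t\<in>T n. h (\<lambda>j\<in>J. X (e t j) \<omega>)) / card (T n)
            - (\<integral>y. h y \<partial>(\<Pi>\<^sub>M j\<in>J. P))\<bar> \<partial>M) \<longlonglongrightarrow> 0"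
    (is "?D \<longlonglongrightarrow> 0")
proof (rule LIMSEQ_I)
  fix \<epsilon> :: real assume \<epsilon>: "0 < \<epsilon>"
  \<comment> \<open>The truncation level is fixed before \<open>n\<close>, so \<open>c n\<close> can
    beat the constant \<open>(real k)\<^sup>2\<close>. With \<open>\<epsilon> / 4\<close> for the
    parameter \<open>\<eta>\<close>, \<open>\<epsilon> / 4\<close> for the variance term and twice
    \<open>\<epsilon> / 8\<close> for the truncation error, the total stays below
    \<open>\<epsilon>\<close>.\<close>
  obtain k :: nat
    where k: "(\<integral>y. \<bar>h y - max (- real k) (min (real k) (h y))\<bar> \<partial>(\<Pi>\<^sub>M j\<in>J. P)) < \<epsilon> / 8"
    using order_tendstoD(2)[OF tendsto_integral_truncation[OF h], of "\<epsilon> / 8"] \<epsilon>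
    by (auto simp: eventually_sequentially)
  have "(\<lambda>n. c n * (real k)\<^sup>2 / (\<epsilon> / 4)) \<longlonglongrightarrow> 0 * (real k)\<^sup>2 / (\<epsilon> / 4)"
    using \<epsilon> by (intro tendsto_intros c) auto
  then have "\<forall>\<^sub>F n in sequentially. c n * (real k)\<^sup>2 / (\<epsilon> / 4) < \<epsilon> / 4"
    by (rule order_tendstoD(2)) (use \<epsilon> in simp)
  then have "\<forall>\<^sub>F n in sequentially. norm (?D n - 0) < \<epsilon>"
    using T(2)
  proof eventually_elim
    case (elim n)
    have "?D n \<le> \<epsilon> / 4 + c n * (real k)\<^sup>2 / (\<epsilon> / 4)
        + 2 * (\<integral>y. \<bar>h y - max (- real k) (min (real k) (h y))\<bar> \<partial>(\<Pi>\<^sub>M j\<in>J. P))"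
      using \<epsilon> by (intro iid_average_L1_bound[OF ind law h _ _ T(1) elim(2) e overlap]) auto
    then have "?D n < \<epsilon>"
      using elim(1) k \<epsilon> by linarith
    moreover have "0 \<le> ?D n"
      by (rule integral_nonneg_AE) auto
    ultimately show ?case
      by simp
  qed
  then show "\<exists>no. \<forall>n\<ge>no. norm (?D n - 0) < \<epsilon>"
    by (simp add: eventually_sequentially)
qed

subsection \<open>Measurability of random simplices\<close>

text \<open>A point \<open>w\<close> of the smaller ball outside the new hull could be separated
  from it by a hyperplane. Shifting both \<open>w\<close> and the hyperplane by \<open>s\<close>
  then separates a point of the old ball from the old vertices.\<close>

lemma cball_subset_convex_hull_perturb:
  fixes y y' :: "'i \<Rightarrow> 'a::euclidean_space"
  assumes I: "finite I"
    and ball: "cball z r \<subseteq> convex hull (y ` I)"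
    and close: "\<And>i. i \<in> I \<Longrightarrow> dist (y' i) (y i) \<le> s"
    and rs: "0 \<le> r"
  shows "cball z (r - s) \<subseteq> convex hull (y' ` I)"
proof
  fix w assume w: "w \<in> cball z (r - s)"
  show "w \<in> convex hull (y' ` I)"
  proof (rule ccontr)
    assume "w \<notin> convex hull (y' ` I)"
    moreover have "closed (convex hull (y' ` I))"
      using I by (intro compact_imp_closed finite_imp_compact_convex_hull) auto
    ultimately obtain a b where ab: "a \<bullet> w < b" "\<And>x. x \<in> convex hull (y' ` I) \<Longrightarrow> b < a \<bullet> x"
      using separating_hyperplane_closed_point[OF convex_convex_hull] by metis
    \<comment> \<open>The centre lies in the old hull, so \<open>I\<close> is not empty; a single
      vertex then rules out \<open>a = 0\<close> and yields \<open>0 \<le> s\<close>.\<close>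
    have "z \<in> convex hull (y ` I)"
      using ball rs by auto
    then obtain i where i: "i \<in> I"
      by fastforce
    then have y'i: "b < a \<bullet> y' i"
      by (intro ab(2) hull_inc) auto
    then have a: "a \<noteq> 0"
      using ab(1) by auto
    have s: "0 \<le> s"
      using close[OF i] zero_le_dist order_trans by blast
    \<comment> \<open>The point \<open>w\<close> moved by distance \<open>s\<close> away from the
      new hull, still within \<open>r\<close> of \<open>z\<close>.\<close>
    define v where "v = w - (s / norm a) *\<^sub>R a"
    have "dist z v \<le> dist z w + dist w v"
      by (rule dist_triangle)
    also have "dist w v = s"
      using a s by (simp add: v_def dist_norm)
    finally have "v \<in> convex hull (y ` I)"
      using w ball by auto
    moreover have "convex hull (y ` I) \<subseteq> {x. a \<bullet> x > b - s * norm a}"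
    proof (rule hull_minimal)
      show "y ` I \<subseteq> {x. a \<bullet> x > b - s * norm a}"
      proof safe
        fix j assume j: "j \<in> I"
        have "a \<bullet> (y' j - y j) \<le> norm a * norm (y' j - y j)"
          by (rule norm_cauchy_schwarz)
        also have "\<dots> \<le> norm a * s"
          using close[OF j] by (intro mult_left_mono) (auto simp: dist_norm)
        finally have "a \<bullet> y' j - a \<bullet> y j \<le> s * norm a"
          by (simp add: inner_diff_right mult.commute)
        moreover have "b < a \<bullet> y' j"
          using j by (intro ab(2) hull_inc) auto
        ultimately show "a \<bullet> y j > b - s * norm a"
          by linarith
      qed
    qed (rule convex_halfspace_gt)
    moreover have "a \<bullet> v = a \<bullet> w - s * norm a"
      using a by (simp add: v_def inner_diff_right dot_square_norm power2_eq_square)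
    ultimately show False
      using ab(1) by auto
  qed
qed

text \<open>Joint openness in vertices and point is the source of all measurability below. Around an
  interior ball of radius \<open>r\<close>, half of \<open>r\<close> absorbs the motion of the
  vertices and half that of the point; only the finitely many coordinates in \<open>I\<close> are
  constrained, so the neighbourhood is open in the product topology.\<close>

lemma open_open_simplex_relation:
  fixes I :: "'i set"
  assumes I: "finite I"
  shows "open {(y :: 'i \<Rightarrow> 'a::euclidean_space, z). z \<in> open_simplex (y ` I)}"
proof (subst open_subopen, intro ballI)
  fix p assume "p \<in> {(y :: 'i \<Rightarrow> 'a, z). z \<in> open_simplex (y ` I)}"
  then obtain y z where p: "p = (y, z)" and z: "z \<in> interior (convex hull (y ` I))"
    by (auto simp: open_simplex_def)
  then obtain r where r: "r > 0" "cball z r \<subseteq> convex hull (y ` I)"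
    by (auto simp: mem_interior_cball)
  define U where "U = (\<Inter>i\<in>I. (\<lambda>y'. y' i) -` ball (y i) (r / 2)) \<times> ball z (r / 2)"
  have "open ((\<lambda>y' :: 'i \<Rightarrow> 'a. y' i) -` ball (y i) (r / 2))" for i
    by (intro open_vimage continuous_on_product_coordinates) auto
  then have "open U"
    unfolding U_def by (intro open_Times open_INT I) auto
  moreover have "p \<in> U"
    using r by (auto simp: U_def p)
  moreover have "U \<subseteq> {(y, z). z \<in> open_simplex (y ` I)}"
  proof safe
    fix y' z' assume U: "(y', z') \<in> U"
    have "cball z (r - r / 2) \<subseteq> convex hull (y' ` I)"
      using U r by (intro cball_subset_convex_hull_perturb[OF I r(2)])
                   (auto simp: U_def dist_commute less_imp_le)
    then have "ball z (r / 2) \<subseteq> convex hull (y' ` I)"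
      using ball_subset_cball[of z "r / 2"] by (auto simp: subset_iff)
    then have "ball z (r / 2) \<subseteq> interior (convex hull (y' ` I))"
      by (intro interior_maximal) auto
    then show "z' \<in> open_simplex (y' ` I)"
      using U by (auto simp: U_def open_simplex_def)
  qed
  ultimately show "\<exists>U. open U \<and> p \<in> U \<and> U \<subseteq> {(y, z). z \<in> open_simplex (y ` I)}"
    by blast
qed

lemma pred_mem_open_simplex [measurable (raw)]:
  fixes f :: "nat \<Rightarrow> 'b \<Rightarrow> 'a::euclidean_space"
  assumes I: "finite I"
    and f: "\<And>i. i \<in> I \<Longrightarrow> f i \<in> borel_measurable N" and g [measurable]: "g \<in> borel_measurable N"
  shows "Measurable.pred N (\<lambda>\<omega>. g \<omega> \<in> open_simplex ((\<lambda>i. f i \<omega>) ` I))"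
proof -
  \<comment> \<open>Measurability is assumed only for indices in \<open>I\<close>, while a map into
    the function space is Borel once all of its countably many coordinates are; the other
    coordinates are set to 0.\<close>
  define F where "F \<omega> = (\<lambda>i. if i \<in> I then f i \<omega> else 0)" for \<omega>
  have "(\<lambda>\<omega>. F \<omega> i) \<in> borel_measurable N" for i
    using f[of i] by (cases "i \<in> I") (auto simp: F_def)
  then have [measurable]: "F \<in> borel_measurable N"
    by (rule measurable_coordinatewise_then_product)
  have "(\<lambda>\<omega>. (F \<omega>, g \<omega>)) -` {(y, z). z \<in> open_simplex (y ` I)} \<inter> space N \<in> sets N"
    by (rule measurable_sets[OF _ borel_open[OF open_open_simplex_relation[OF I]]]) measurable
  also have "(\<lambda>\<omega>. (F \<omega>, g \<omega>)) -` {(y, z). z \<in> open_simplex (y ` I)} \<inter> space N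
      = {\<omega> \<in> space N. g \<omega> \<in> open_simplex ((\<lambda>i. f i \<omega>) ` I)}"
    by (auto simp: F_def cong: image_cong)
  finally show ?thesis
    by (simp add: pred_def)
qed

lemma sets_open_simplex [measurable]: "open_simplex V \<in> sets borel"
  by (simp add: open_simplex_def)

lemma measure_lebesgue_open_simplex [simp]:
  "measure lebesgue (open_simplex V) = measure lborel (open_simplex V)"
  by (simp add: measure_completion sets_open_simplex)

text \<open>The volume is the measure of a section of a set that is measurable in the product with
  \<open>lborel\<close>, and such section measures depend measurably on the parameter.\<close>

lemma borel_measurable_measure_open_simplex [measurable (raw)]:
  fixes f :: "nat \<Rightarrow> 'b \<Rightarrow> 'a::euclidean_space"
  assumes I: "finite I" and f: "\<And>i. i \<in> I \<Longrightarrow> f i \<in> borel_measurable N"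
  shows "(\<lambda>\<omega>. measure lborel (open_simplex ((\<lambda>i. f i \<omega>) ` I))) \<in> borel_measurable N"
proof (rule lborel.measurable_measure)
  have "Measurable.pred (N \<Otimes>\<^sub>M lborel) (\<lambda>p. snd p \<in> open_simplex ((\<lambda>i. f i (fst p)) ` I))"
    by (intro pred_mem_open_simplex I measurable_compose[OF measurable_fst f]) auto
  then show "{p \<in> space (N \<Otimes>\<^sub>M lborel). snd p \<in> open_simplex ((\<lambda>i. f i (fst p)) ` I)} \<in> sets (N \<Otimes>\<^sub>M lborel)"
    by (simp add: pred_def)
qed auto

text \<open>Each value is counted at the first index where it occurs. This keeps the count correct
  when sample points coincide and makes it a finite sum of measurable terms.\<close>

lemma card_image_lessThan_Int:
  fixes x :: "nat \<Rightarrow> 'a"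
  shows "card (x ` {..<n} \<inter> B) = (\<Sum>j<n. if x j \<notin> x ` {..<j} \<and> x j \<in> B then 1 else 0)"
proof (induction n)
  case (Suc n)
  have "x ` {..<Suc n} \<inter> B =
      (if x n \<notin> x ` {..<n} \<and> x n \<in> B then insert (x n) (x ` {..<n} \<inter> B) else x ` {..<n} \<inter> B)"
    by (auto simp: lessThan_Suc)
  then show ?case
    using Suc by (simp add: card_insert_disjoint)
qed simp

lemma borel_measurable_card_other_points:
  fixes X :: "nat \<Rightarrow> 'b \<Rightarrow> 'a::euclidean_space"
  assumes X [measurable]: "\<And>i. X i \<in> borel_measurable N" and I: "finite I"
  shows "(\<lambda>\<omega>. real (card (other_points_in_simplex n (\<lambda>i. X i \<omega>) I))) \<in> borel_measurable N"
proof -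
  have *: "other_points_in_simplex n (\<lambda>i. X i \<omega>) I
      = (\<lambda>i. X i \<omega>) ` {..<n} \<inter> {z. z \<notin> (\<lambda>i. X i \<omega>) ` I \<and> z \<in> open_simplex ((\<lambda>i. X i \<omega>) ` I)}" for \<omega>
    by (auto simp: other_points_in_simplex_def)
  have [measurable]: "Measurable.pred N (\<lambda>\<omega>. X j \<omega> \<notin> (\<lambda>i. X i \<omega>) ` J)" if "finite J" for j J
  proof -
    have "Measurable.pred N (\<lambda>\<omega>. X j \<omega> - X i \<omega> = 0)" for i
      by measurable
    then have "Measurable.pred N (\<lambda>\<omega>. \<forall>i\<in>J. X j \<omega> - X i \<omega> \<noteq> 0)"
      using that by (intro pred_intros_finite) auto
    then show ?thesis
      by (auto simp: image_iff)
  qed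
  have [measurable]: "Measurable.pred N (\<lambda>\<omega>. X j \<omega> \<in> open_simplex ((\<lambda>i. X i \<omega>) ` I))" for j
    by (intro pred_mem_open_simplex I X)
  show ?thesis
    unfolding * card_image_lessThan_Int mem_Collect_eq
    using I by measurable
qed

text \<open>The random set enters the estimator only through its volume, so measurability of the
  volume suffices.\<close>

lemma borel_measurable_nonconvexity_estimator:
  fixes X :: "nat \<Rightarrow> 'b \<Rightarrow> 'a::euclidean_space"
  assumes X: "\<And>i. X i \<in> borel_measurable N"
    and A: "(\<lambda>\<omega>. measure lebesgue (A \<omega>)) \<in> borel_measurable N"
  shows "(\<lambda>\<omega>. nonconvexity_estimator n (\<lambda>i. X i \<omega>) (A \<omega>)) \<in> borel_measurable N"
  unfolding nonconvexity_estimator_def measure_lebesgue_open_simplex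
  by (intro borel_measurable_diff borel_measurable_const borel_measurable_times borel_measurable_sum
      borel_measurable_divide borel_measurable_card_other_points borel_measurable_measure_open_simplex
      X A) (auto intro: finite_subset[OF _ finite_lessThan])

subsection \<open>Pairs of a set and an index outside it\<close>

text \<open>A pair consists of the indices of the vertices and the index of the point tested against
  the simplex. The vertices stay unordered because the simplex depends only on their set.\<close>

definition pointed_subsets :: "nat \<Rightarrow> 'i set \<Rightarrow> ('i set \<times> 'i) set" where
  "pointed_subsets k A = (SIGMA I:{I. I \<subseteq> A \<and> card I = k}. A - I)"

lemma finite_pointed_subsets [simp]: "finite A \<Longrightarrow> finite (pointed_subsets k A)"
  by (auto simp: pointed_subsets_def)

lemma card_pointed_subsets:
  assumes A: "finite A"
  shows "card (pointed_subsets k A) = (card A choose k) * (card A - k)"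
proof -
  have "card (pointed_subsets k A) = (\<Sum>I | I \<subseteq> A \<and> card I = k. card (A - I))"
    using A unfolding pointed_subsets_def by (subst card_SigmaI) auto
  also have "\<dots> = (\<Sum>I | I \<subseteq> A \<and> card I = k. card A - k)"
    using A by (intro sum.cong) (auto simp: card_Diff_subset finite_subset)
  also have "\<dots> = (card A choose k) * (card A - k)"
    using A by (simp add: n_subsets)
  finally show ?thesis .
qed

text \<open>By symmetry every element occurs in the same proportion of pairs. The proof counts the
  complement: pairs avoiding \<open>a\<close> are the pairs over \<open>A - {a}\<close>, and
  binomial absorption relates the two totals.\<close>

lemma card_pointed_subsets_containing:
  assumes A: "finite A" and a: "a \<in> A"
  shows "card A * card {t \<in> pointed_subsets k A. a \<in> insert (snd t) (fst t)}
    = Suc k * card (pointed_subsets k A)"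
proof -
  define n where "n = card A"
  define C where "C = {t \<in> pointed_subsets k A. a \<in> insert (snd t) (fst t)}"
  have "pointed_subsets k A = C \<union> pointed_subsets k (A - {a})" "C \<inter> pointed_subsets k (A - {a}) = {}"
    by (auto simp: C_def pointed_subsets_def)
  then have "card (pointed_subsets k A) = card C + card (pointed_subsets k (A - {a}))"
    using A card_Un_disjoint[of C "pointed_subsets k (A - {a})"] by (simp add: C_def)
  moreover have "card (A - {a}) = n - 1"
    using A a by (simp add: n_def)
  ultimately have eq: "(n choose k) * (n - k) = card C + (n - 1 choose k) * (n - 1 - k)"
    using A by (simp add: card_pointed_subsets n_def)
  define p q c where "p = n choose k" and "q = n - 1 choose k" and "c = card C"
  have eq: "p * (n - k) = c + q * (n - 1 - k)" and absorb: "n * q = (n - k) * p"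
    using eq binomial_absorb_comp[of n k] by (simp_all only: p_def q_def c_def)
  have "n * c = Suc k * (p * (n - k))"
  proof (cases "n > k")
    case True
    \<comment> \<open>With \<open>m\<close> in place of \<open>n - 1 - k\<close> the truncated
      subtractions disappear. In the other case \<open>n - k\<close> is 0 and \<open>eq\<close>
      forces \<open>c = 0\<close>.\<close>
    then obtain m where m: "n = Suc k + m"
      by (metis less_iff_Suc_add add_Suc)
    have "n * c + n * q * m = n * (p * (n - k))"
      unfolding eq by (simp add: m algebra_simps)
    then have "n * c + (n - k) * p * m = n * (p * (n - k))"
      by (simp only: absorb)
    also have "\<dots> = Suc k * (p * (n - k)) + (n - k) * p * m"
      unfolding m by (simp add: algebra_simps)
    finally show ?thesis
      by simp
  next
    case False
    then show ?thesis
      using eq by simp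
  qed
  then show ?thesis
    using A by (simp only: C_def n_def p_def c_def card_pointed_subsets)
qed

text \<open>A union bound over the \<open>Suc k\<close> indices of \<open>t\<close>, each of which
  occurs in a proportion \<open>Suc k / card A\<close> of all pairs.\<close>

lemma card_overlapping_pointed_subsets_le:
  assumes A: "finite A" and t: "t \<in> pointed_subsets k A"
  shows "real (card {u \<in> pointed_subsets k A.
      insert (snd t) (fst t) \<inter> insert (snd u) (fst u) \<noteq> {}})
    \<le> (real (Suc k))\<^sup>2 / card A * card (pointed_subsets k A)"
proof -
  let ?s = "\<lambda>t. insert (snd t) (fst t)"
  have sub: "?s t \<subseteq> A" and card: "card (?s t) = Suc k"
  proof -
    obtain I j where [simp]: "t = (I, j)"
      by (cases t)
    have "I \<subseteq> A" "card I = k" "j \<in> A" "j \<notin> I"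
      using t by (auto simp: pointed_subsets_def)
    moreover from this have "finite I"
      using A finite_subset by blast
    ultimately show "?s t \<subseteq> A" "card (?s t) = Suc k"
      by auto
  qed
  have fin: "finite (?s t)"
    by (rule finite_subset[OF sub A])
  have "A \<noteq> {}"
    using sub by blast
  then have "card A > 0"
    using A by (simp add: card_gt_0_iff)
  have eq: "real (card {u \<in> pointed_subsets k A. a \<in> ?s u})
      = Suc k * card (pointed_subsets k A) / card A" if "a \<in> ?s t" for a
  proof -
    have "a \<in> A"
      using sub that by blast
    then show ?thesis
      using card_pointed_subsets_containing[OF A, of a k] \<open>card A > 0\<close>
      by (simp add: field_simps del: of_nat_Suc mult_Suc flip: of_nat_mult)
  qed
  have "{u \<in> pointed_subsets k A. ?s t \<inter> ?s u \<noteq> {}} \<subseteq> (\<Union>a\<in>?s t. {u \<in> pointed_subsets k A. a \<in> ?s u})"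
    by blast
  then have "card {u \<in> pointed_subsets k A. ?s t \<inter> ?s u \<noteq> {}}
      \<le> (\<Sum>a\<in>?s t. card {u \<in> pointed_subsets k A. a \<in> ?s u})"
    using A fin by (intro order_trans[OF card_mono card_UN_le]) auto
  then have "real (card {u \<in> pointed_subsets k A. ?s t \<inter> ?s u \<noteq> {}})
      \<le> (\<Sum>a\<in>?s t. real (card {u \<in> pointed_subsets k A. a \<in> ?s u}))"
    by (simp flip: of_nat_sum)
  also have "\<dots> = (\<Sum>a\<in>?s t. Suc k * card (pointed_subsets k A) / card A)"
    by (intro sum.cong eq) auto
  also have "\<dots> = (real (Suc k))\<^sup>2 / card A * card (pointed_subsets k A)"
    using card by (simp add: power2_eq_square algebra_simps add_divide_distrib)
  finally show ?thesis .
qed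

text \<open>For distinct sample points, counting points in a simplex is the same as counting
  indices, and the normalising constants of the estimator multiply to the number of pairs.\<close>

lemma nonconvexity_estimator_eq:
  fixes x :: "nat \<Rightarrow> 'a::euclidean_space"
  assumes inj: "inj_on x {..<n}"
  shows "nonconvexity_estimator n x A = 1 - measure lebesgue A *
    ((\<Sum>t\<in>pointed_subsets (Suc DIM('a)) {..<n}.
        indicator (open_simplex (x ` fst t)) (x (snd t)) / measure lborel (open_simplex (x ` fst t)))
      / card (pointed_subsets (Suc DIM('a)) {..<n}))"
proof -
  define k where "k = Suc DIM('a)"
  let ?h = "\<lambda>I j. indicator (open_simplex (x ` I)) (x j) / measure lborel (open_simplex (x ` I)) :: real"
  let ?K = "{I. I \<subseteq> {..<n} \<and> card I = k}"
  have card: "real (card (other_points_in_simplex n x I)) = (\<Sum>j\<in>{..<n} - I. indicator (open_simplex (x ` I)) (x j))"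
    if "I \<in> ?K" for I
  proof -
    have I: "I \<subseteq> {..<n}"
      using that by simp
    have "x ` {..<n} - x ` I = x ` ({..<n} - I)"
      using inj I by (intro inj_on_image_set_diff[symmetric]) auto
    then have "other_points_in_simplex n x I = x ` {j \<in> {..<n} - I. x j \<in> open_simplex (x ` I)}"
      unfolding other_points_in_simplex_def by auto
    then have "card (other_points_in_simplex n x I) = card {j \<in> {..<n} - I. x j \<in> open_simplex (x ` I)}"
      using inj by (auto intro!: card_image inj_on_subset[OF inj])
    then show ?thesis
      by (simp add: indicator_def sum.If_cases Int_def)
  qed
  have "(\<Sum>I\<in>?K. real (card (other_points_in_simplex n x I)) * measure lebesgue A
        / ((real n - real k) * measure lborel (open_simplex (x ` I))))
      = (\<Sum>I\<in>?K. measure lebesgue A / (real n - real k) * (\<Sum>j\<in>{..<n} - I. ?h I j))"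
    by (intro sum.cong refl) (simp add: card sum_divide_distrib[symmetric])
  also have "\<dots> = measure lebesgue A / (real n - real k) * (\<Sum>t\<in>pointed_subsets k {..<n}. ?h (fst t) (snd t))"
    unfolding pointed_subsets_def sum_distrib_left[symmetric]
    by (subst sum.Sigma) (auto simp: split_def)
  finally have "nonconvexity_estimator n x A = 1 - 1 / real (n choose k) *
      (measure lebesgue A / (real n - real k) * (\<Sum>t\<in>pointed_subsets k {..<n}. ?h (fst t) (snd t)))"
    unfolding nonconvexity_estimator_def measure_lebesgue_open_simplex by (simp add: k_def algebra_simps)
  also have "\<dots> = 1 - measure lebesgue A * ((\<Sum>t\<in>pointed_subsets k {..<n}. ?h (fst t) (snd t))
      / (real (n choose k) * (real n - real k)))"
    by simp
  \<comment> \<open>For \<open>n < k\<close> the factor \<open>real n - real k\<close> is negative,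
    but the binomial coefficient and the number of pairs are both 0.\<close>
  also have "real (n choose k) * (real n - real k) = card (pointed_subsets k {..<n})"
    by (cases "k \<le> n") (auto simp: card_pointed_subsets of_nat_diff)
  finally show ?thesis
    by (simp add: k_def)
qed

subsection \<open>Convergence in probability\<close>

text \<open>The indicators of the deviation events tend to 0 almost surely and are bounded by 1, so
  dominated convergence applies to their integrals.\<close>

lemma (in prob_space) converges_in_probability_AE:
  assumes Z [measurable]: "\<And>n. Z n \<in> borel_measurable M"
    and lim: "AE \<omega> in M. (\<lambda>n. Z n \<omega>) \<longlonglongrightarrow> c"
  shows "converges_in_probability M Z c"
  unfolding converges_in_probability_def
proof (intro conjI allI impI Z)
  fix \<epsilon> :: real assume \<epsilon>: "\<epsilon> > 0"
  have [measurable]: "Z n \<in> borel_measurable M" for n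
    by (rule Z)
  have "(\<lambda>n. \<integral>\<omega>. indicator {\<omega> \<in> space M. \<bar>Z n \<omega> - c\<bar> > \<epsilon>} \<omega> \<partial>M) \<longlonglongrightarrow> (\<integral>\<omega>. (0 :: real) \<partial>M)"
  proof (rule integral_dominated_convergence[where w = "\<lambda>_. 1"])
    show "AE \<omega> in M. (\<lambda>n. indicator {\<omega> \<in> space M. \<bar>Z n \<omega> - c\<bar> > \<epsilon>} \<omega>) \<longlonglongrightarrow> (0 :: real)"
      using lim
    proof eventually_elim
      case (elim \<omega>)
      have "\<forall>\<^sub>F n in sequentially. dist (Z n \<omega>) c < \<epsilon>"
        using elim \<epsilon> by (rule tendstoD)
      then have "\<forall>\<^sub>F n in sequentially. indicator {\<omega> \<in> space M. \<bar>Z n \<omega> - c\<bar> > \<epsilon>} \<omega> = (0 :: real)"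
        by eventually_elim (auto simp: dist_real_def)
      then show ?case
        by (rule tendsto_eventually)
    qed
  qed (auto simp: indicator_def)
  then show "(\<lambda>n. prob {\<omega> \<in> space M. \<bar>Z n \<omega> - c\<bar> > \<epsilon>}) \<longlonglongrightarrow> 0"
    by simp
qed

text \<open>Markov's inequality, after enlarging the strict deviation event to the non-strict
  one.\<close>

lemma (in prob_space) converges_in_probability_L1:
  assumes Z: "\<And>n. integrable M (Z n)"
    and lim: "(\<lambda>n. \<integral>\<omega>. \<bar>Z n \<omega> - c\<bar> \<partial>M) \<longlonglongrightarrow> 0"
  shows "converges_in_probability M Z c"
  unfolding converges_in_probability_def
proof (intro conjI allI impI borel_measurable_integrable Z)
  fix \<epsilon> :: real assume \<epsilon>: "\<epsilon> > 0"
  have [measurable]: "Z n \<in> borel_measurable M" for n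
    using Z by auto
  have le: "prob {\<omega> \<in> space M. \<bar>Z n \<omega> - c\<bar> > \<epsilon>} \<le> (\<integral>\<omega>. \<bar>Z n \<omega> - c\<bar> \<partial>M) / \<epsilon>" for n
  proof -
    have "prob {\<omega> \<in> space M. \<bar>Z n \<omega> - c\<bar> > \<epsilon>} \<le> prob {\<omega> \<in> space M. \<bar>Z n \<omega> - c\<bar> \<ge> \<epsilon>}"
      by (intro finite_measure_mono) auto
    also have "\<dots> \<le> (\<integral>\<omega>. \<bar>Z n \<omega> - c\<bar> \<partial>M) / \<epsilon>"
      using Z \<epsilon> by (intro integral_Markov_inequality_measure[where A = "space M"]) auto
    finally show ?thesis .
  qed
  have "(\<lambda>n. (\<integral>\<omega>. \<bar>Z n \<omega> - c\<bar> \<partial>M) / \<epsilon>) \<longlonglongrightarrow> 0"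
    using tendsto_divide[OF lim tendsto_const[of \<epsilon>]] \<epsilon> by simp
  then show "(\<lambda>n. prob {\<omega> \<in> space M. \<bar>Z n \<omega> - c\<bar> > \<epsilon>}) \<longlonglongrightarrow> 0"
    by (rule Lim_null_comparison[rotated]) (auto intro!: always_eventually le)
qed

lemma (in prob_space) converges_in_probability_mult:
  assumes A: "converges_in_probability M A a" and B: "converges_in_probability M B b"
  shows "converges_in_probability M (\<lambda>n \<omega>. A n \<omega> * B n \<omega>) (a * b)"
  unfolding converges_in_probability_def
proof (intro conjI allI impI)
  have [measurable]: "A n \<in> borel_measurable M" "B n \<in> borel_measurable M" for n
    using A B by (auto simp: converges_in_probability_def)
  show "(\<lambda>\<omega>. A n \<omega> * B n \<omega>) \<in> borel_measurable M" for n
    by measurable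
  fix \<epsilon> :: real assume \<epsilon>: "\<epsilon> > 0"
  \<comment> \<open>The bound 1 makes the product of the two deviations at most
    \<open>\<eta>\<close>; the three error terms then add up to at most
    \<open>(\<bar>a\<bar> + 1 + \<bar>b\<bar>) * \<eta>\<close>.\<close>
  define \<eta> where "\<eta> = min 1 (\<epsilon> / (\<bar>a\<bar> + 1 + \<bar>b\<bar>))"
  have \<eta>: "0 < \<eta>" "\<eta> \<le> 1" "(\<bar>a\<bar> + 1 + \<bar>b\<bar>) * \<eta> \<le> \<epsilon>"
  proof -
    have c: "0 < \<bar>a\<bar> + 1 + \<bar>b\<bar>"
      by linarith
    show "0 < \<eta>" "\<eta> \<le> 1"
      using \<epsilon> c by (auto simp: \<eta>_def)
    have "(\<bar>a\<bar> + 1 + \<bar>b\<bar>) * \<eta> \<le> (\<bar>a\<bar> + 1 + \<bar>b\<bar>) * (\<epsilon> / (\<bar>a\<bar> + 1 + \<bar>b\<bar>))"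
      using c by (intro mult_left_mono) (auto simp: \<eta>_def)
    then show "(\<bar>a\<bar> + 1 + \<bar>b\<bar>) * \<eta> \<le> \<epsilon>"
      using c by simp
  qed
  define PA PB where "PA n = prob {\<omega> \<in> space M. \<bar>A n \<omega> - a\<bar> > \<eta>}"
    and "PB n = prob {\<omega> \<in> space M. \<bar>B n \<omega> - b\<bar> > \<eta>}" for n
  have close: "\<bar>u * v - a * b\<bar> \<le> \<epsilon>" if "\<bar>u - a\<bar> \<le> \<eta>" "\<bar>v - b\<bar> \<le> \<eta>" for u v
  proof -
    have "u * v - a * b = (u - a) * (v - b) + a * (v - b) + (u - a) * b"
      by (simp add: algebra_simps)
    then have "\<bar>u * v - a * b\<bar> \<le> \<bar>u - a\<bar> * \<bar>v - b\<bar> + \<bar>a\<bar> * \<bar>v - b\<bar> + \<bar>u - a\<bar> * \<bar>b\<bar>"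
      unfolding abs_mult[symmetric] by linarith
    also have "\<dots> \<le> \<eta> * 1 + \<bar>a\<bar> * \<eta> + \<eta> * \<bar>b\<bar>"
      using that \<eta> by (intro add_mono mult_mono) auto
    also have "\<dots> \<le> \<epsilon>"
      using \<eta>(3) by (simp add: algebra_simps)
    finally show ?thesis .
  qed
  have le: "prob {\<omega> \<in> space M. \<bar>A n \<omega> * B n \<omega> - a * b\<bar> > \<epsilon>} \<le> PA n + PB n" for n
  proof -
    have "prob {\<omega> \<in> space M. \<bar>A n \<omega> * B n \<omega> - a * b\<bar> > \<epsilon>}
        \<le> prob ({\<omega> \<in> space M. \<bar>A n \<omega> - a\<bar> > \<eta>} \<union> {\<omega> \<in> space M. \<bar>B n \<omega> - b\<bar> > \<eta>})"
    proof (rule finite_measure_mono)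
      show "{\<omega> \<in> space M. \<bar>A n \<omega> * B n \<omega> - a * b\<bar> > \<epsilon>}
          \<subseteq> {\<omega> \<in> space M. \<bar>A n \<omega> - a\<bar> > \<eta>} \<union> {\<omega> \<in> space M. \<bar>B n \<omega> - b\<bar> > \<eta>}"
        using close by (fastforce simp: not_less[symmetric])
    qed measurable
    also have "\<dots> \<le> PA n + PB n"
      unfolding PA_def PB_def by (intro measure_Un_le) measurable
    finally show ?thesis .
  qed
  have "PA \<longlonglongrightarrow> 0" "PB \<longlonglongrightarrow> 0"
    using A B \<eta>(1) unfolding converges_in_probability_def PA_def PB_def by auto
  then have "(\<lambda>n. PA n + PB n) \<longlonglongrightarrow> 0"
    by (rule tendsto_add_zero)
  then show "(\<lambda>n. prob {\<omega> \<in> space M. \<bar>A n \<omega> * B n \<omega> - a * b\<bar> > \<epsilon>}) \<longlonglongrightarrow> 0"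
    by (rule Lim_null_comparison[rotated]) (auto intro!: always_eventually le)
qed

text \<open>Deviation probabilities are compared separately for each \<open>n\<close>, so an almost
  sure identity is enough. Measurability of \<open>Z\<close> is a separate hypothesis because it
  does not pass through almost sure equality in general.\<close>

lemma (in prob_space) converges_in_probability_1_minus_AE:
  assumes Z: "\<And>n. Z n \<in> borel_measurable M"
    and W: "converges_in_probability M W c"
    and eq: "\<And>n. AE \<omega> in M. Z n \<omega> = 1 - W n \<omega>"
  shows "converges_in_probability M Z (1 - c)"
  unfolding converges_in_probability_def
proof (intro conjI allI impI Z)
  fix \<epsilon> :: real assume \<epsilon>: "\<epsilon> > 0"
  have [measurable]: "Z n \<in> borel_measurable M" "W n \<in> borel_measurable M" for n
    using Z W by (auto simp: converges_in_probability_def)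
  have "prob {\<omega> \<in> space M. \<bar>Z n \<omega> - (1 - c)\<bar> > \<epsilon>} = prob {\<omega> \<in> space M. \<bar>W n \<omega> - c\<bar> > \<epsilon>}" for n
    by (rule finite_measure_eq_AE) (use eq[of n] in \<open>auto elim!: eventually_mono\<close>)
  then show "(\<lambda>n. prob {\<omega> \<in> space M. \<bar>Z n \<omega> - (1 - c)\<bar> > \<epsilon>}) \<longlonglongrightarrow> 0"
    using W \<epsilon> by (simp add: converges_in_probability_def)
qed

text \<open>Two of the variables have joint law \<open>P \<Otimes>\<^sub>M P\<close>, and
  integrating over one coordinate shows that its diagonal is null when \<open>P\<close> has no
  atoms. Countably many pairs of indices are then combined.\<close>

lemma (in prob_space) AE_iid_inj:
  fixes X :: "nat \<Rightarrow> 'a \<Rightarrow> 'b::euclidean_space"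
  assumes ind: "indep_vars (\<lambda>_. borel) X UNIV"
    and law: "\<And>i. distr M borel (X i) = P"
    and diffuse: "\<And>x. emeasure P {x} = 0"
  shows "AE \<omega> in M. inj (\<lambda>i. X i \<omega>)"
proof -
  have rv [measurable]: "X i \<in> borel_measurable M" for i
    using ind by (auto simp: indep_vars_def)
  have [measurable_cong]: "sets P = sets borel"
    using law[of undefined, symmetric] by simp
  interpret P: prob_space P
    using prob_space_distr[OF rv, of undefined] law by simp
  interpret PP: pair_prob_space P P ..
  have meas: "Measurable.pred (borel \<Otimes>\<^sub>M borel) (\<lambda>p. fst p - snd p \<noteq> (0 :: 'b))"
    by measurable
  have "{x} \<in> null_sets P" for x
    using diffuse by (auto simp: \<open>sets P = sets borel\<close>)
  then have "AE y in P. x - y \<noteq> 0" for x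
    using AE_not_in[of "{x}" P] by (auto elim: eventually_mono)
  then have AE: "AE p in P \<Otimes>\<^sub>M P. fst p - snd p \<noteq> 0"
    by (intro PP.AE_pair_measure) (use meas in \<open>auto simp: pred_def space_pair_measure\<close>)
  have "AE \<omega> in M. X i \<omega> \<noteq> X j \<omega>" if "i \<noteq> j" for i j
  proof -
    have "indep_var borel ((\<lambda>x. x i) \<circ> (\<lambda>\<omega>. \<lambda>l\<in>{i}. X l \<omega>)) borel ((\<lambda>x. x j) \<circ> (\<lambda>\<omega>. \<lambda>l\<in>{j}. X l \<omega>))"
      using that by (intro indep_var_compose[OF indep_var_restrict[OF ind]]) auto
    then have "indep_var borel (X i) borel (X j)"
      by (simp add: comp_def)
    then have eq: "P \<Otimes>\<^sub>M P = distr M (borel \<Otimes>\<^sub>M borel) (\<lambda>\<omega>. (X i \<omega>, X j \<omega>))"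
      using law by (simp add: indep_var_distribution_eq)
    have "AE p in distr M (borel \<Otimes>\<^sub>M borel) (\<lambda>\<omega>. (X i \<omega>, X j \<omega>)). fst p - snd p \<noteq> 0"
      by (rule AE[unfolded eq])
    then show ?thesis
      by (subst (asm) AE_distr_iff) (use meas in \<open>auto simp: pred_def\<close>)
  qed
  then have "AE \<omega> in M. \<forall>i j. i \<noteq> j \<longrightarrow> X i \<omega> \<noteq> X j \<omega>"
    by (auto simp: AE_all_countable)
  then show ?thesis
    by (auto simp: inj_def elim: eventually_mono)
qed

lemma abs_measure_diff_le_d_mu:
  assumes S: "S \<in> lmeasurable" and A: "A \<in> sets lebesgue" and fin: "d_mu S A < \<infinity>"
  shows "\<bar>measure lebesgue A - measure lebesgue S\<bar> \<le> enn2real (d_mu S A)"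
proof -
  have AS: "A - S \<in> lmeasurable"
    using fin A S by (auto simp: d_mu_def fmeasurable_def)
  have SA: "S - A \<in> lmeasurable"
    using S A by (intro fmeasurableI2[OF S]) (auto simp: fmeasurableD)
  \<comment> \<open>Real-valued \<open>measure\<close> sends infinite volume to 0, so
    \<open>A\<close> must first be shown to have finite volume; it is rebuilt here from sets already
    known to be finite.\<close>
  have "A = (A - S) \<union> (S - (S - A))"
    by blast
  then have lA: "A \<in> lmeasurable"
    using AS SA S by (metis fmeasurable.Un fmeasurable.Diff)
  have "enn2real (d_mu S A) = measure lebesgue (S - A) + measure lebesgue (A - S)"
    using AS SA by (simp add: d_mu_def emeasure_eq_measure2 flip: ennreal_plus)
  moreover have "measure lebesgue A \<le> measure lebesgue (S \<union> (A - S))"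
    using lA S AS by (intro measure_mono_fmeasurable) auto
  moreover have "\<dots> \<le> measure lebesgue S + measure lebesgue (A - S)"
    using S AS by (intro measure_Un_le) auto
  moreover have "measure lebesgue S \<le> measure lebesgue (A \<union> (S - A))"
    using lA S SA by (intro measure_mono_fmeasurable) auto
  moreover have "\<dots> \<le> measure lebesgue A + measure lebesgue (S - A)"
    using lA SA by (intro measure_Un_le) auto
  ultimately show ?thesis
    using measure_nonneg[of lebesgue "S - A"] measure_nonneg[of lebesgue "A - S"] by linarith
qed

text \<open>Early members of the sequence may have infinite volume. Convergence to 0 in
  \<open>ennreal\<close> makes the distance finite eventually, where the previous estimate
  applies.\<close>

lemma tendsto_measure_of_d_mu:
  assumes S: "S \<in> lmeasurable" and A: "\<And>n. A n \<in> sets lebesgue"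
    and lim: "(\<lambda>n. d_mu S (A n)) \<longlonglongrightarrow> 0"
  shows "(\<lambda>n. measure lebesgue (A n)) \<longlonglongrightarrow> measure lebesgue S"
proof (rule LIM_zero_cancel, rule Lim_null_comparison)
  have "\<forall>\<^sub>F n in sequentially. d_mu S (A n) < \<infinity>"
    using lim by (rule order_tendstoD) auto
  then show "\<forall>\<^sub>F n in sequentially. norm (measure lebesgue (A n) - measure lebesgue S) \<le> enn2real (d_mu S (A n))"
    by eventually_elim (auto intro!: abs_measure_diff_le_d_mu S A)
  show "(\<lambda>n. enn2real (d_mu S (A n))) \<longlonglongrightarrow> 0"
    using tendsto_enn2real[of "\<lambda>n. d_mu S (A n)" 0] lim by simp
qed

subsection \<open>The kernel and its mean\<close>

text \<open>
  For a degenerate simplex both the indicator and the volume vanish, and the value is \<open>0/0 = 0\<close>.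
\<close>

definition simplex_kernel :: "nat \<Rightarrow> (nat \<Rightarrow> 'a::euclidean_space) \<Rightarrow> real" where
  "simplex_kernel d y =
     indicator (open_simplex (y ` {..d})) (y (Suc d)) / measure lborel (open_simplex (y ` {..d}))"

lemma borel_measurable_simplex_kernel [measurable]:
  "simplex_kernel d \<in> borel_measurable (\<Pi>\<^sub>M i\<in>{..Suc d}. borel)"
proof -
  have [measurable]: "Measurable.pred (\<Pi>\<^sub>M i\<in>{..Suc d}. borel)
      (\<lambda>y :: nat \<Rightarrow> 'a. y (Suc d) \<in> open_simplex ((\<lambda>i. y i) ` {..d}))"
    by (intro pred_mem_open_simplex) auto
  have [measurable]: "(\<lambda>y :: nat \<Rightarrow> 'a. measure lborel (open_simplex ((\<lambda>i. y i) ` {..d})))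
      \<in> borel_measurable (\<Pi>\<^sub>M i\<in>{..Suc d}. borel)"
    by (intro borel_measurable_measure_open_simplex) auto
  show ?thesis
    unfolding simplex_kernel_def indicator_def of_bool_def by measurable
qed

text \<open>Integrating out the last point leaves \<open>q y\<close>, the \<open>P\<close>-mass of
  the simplex divided by its volume. As \<open>P\<close> has density at most
  \<open>1 / measure lborel S\<close>, this ratio is bounded even though the kernel is not, which
  gives integrability; up to the factor \<open>measure lborel S\<close>, it is the integrand of
  \<open>nonconvexity\<close>.\<close>

lemma
  fixes S :: "'a::euclidean_space set"
  assumes S: "S \<in> sets borel" "emeasure lborel S \<noteq> 0" "emeasure lborel S \<noteq> \<infinity>"
  defines "P \<equiv> uniform_measure lborel S"
  shows integrable_simplex_kernel: "integrable (\<Pi>\<^sub>M i\<in>{..Suc DIM('a)}. P) (simplex_kernel DIM('a))"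
    and nonconvexity_eq_integral_simplex_kernel:
      "nonconvexity S = 1 - measure lborel S * (\<integral>y. simplex_kernel DIM('a) y \<partial>(\<Pi>\<^sub>M i\<in>{..Suc DIM('a)}. P))"
proof -
  define d where "d = DIM('a)"
  interpret P: prob_space P
    unfolding P_def using S by (intro prob_space_uniform_measure) auto
  interpret prod: product_sigma_finite "\<lambda>_. P" ..
  interpret V: prob_space "\<Pi>\<^sub>M i\<in>{..d}. P"
    by (intro prob_space_PiM P.prob_space_axioms)
  have [measurable_cong]: "sets P = sets borel"
    by (simp add: P_def)
  have ins: "{..Suc d} = insert (Suc d) {..d}" "Suc d \<notin> {..d}"
    by auto
  have meas [measurable]: "simplex_kernel d \<in> borel_measurable (\<Pi>\<^sub>M i\<in>{..Suc d}. P)"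
    using borel_measurable_simplex_kernel[of d]
    by (subst measurable_cong_sets[OF sets_PiM_cong refl]) (auto simp: \<open>sets P = sets borel\<close>)
  have Spos: "measure lborel S > 0"
    using S by (simp add: measure_def enn2real_positive_iff zero_less_iff_neq_zero top.not_eq_extremum[symmetric])
  define q where "q y = measure P (open_simplex (y ` {..d})) / measure lborel (open_simplex (y ` {..d}))" for y :: "nat \<Rightarrow> 'a"
  have upd: "(y(Suc d := z)) ` {..d} = y ` {..d}" for y :: "nat \<Rightarrow> 'a" and z
    by auto
  have P_simplex: "measure P D = measure lborel (D \<inter> S) / measure lborel S" if "D \<in> sets borel" for D
    using S that unfolding P_def by (subst measure_uniform_measure) (auto simp: Int_commute)
  have q: "0 \<le> q y" "q y \<le> 1 / measure lborel S" for y
  proof -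
    let ?D = "open_simplex (y ` {..d})"
    show "0 \<le> q y"
      by (simp add: q_def)
    have "compact (convex hull (y ` {..d}))"
      by (intro finite_imp_compact_convex_hull) auto
    then have "bounded ?D"
      unfolding open_simplex_def by (meson bounded_subset compact_imp_bounded interior_subset)
    then have "emeasure lborel ?D < \<infinity>"
      by (rule emeasure_bounded_finite)
    then have "measure lborel (?D \<inter> S) \<le> measure lborel ?D"
      using S by (intro measure_mono_fmeasurable) (auto simp: fmeasurable_def)
    then have "measure P ?D \<le> measure lborel ?D / measure lborel S"
      using Spos by (simp add: P_simplex divide_right_mono)
    \<comment> \<open>For a simplex of volume 0 the quotient is 0 by the convention for division by
      zero.\<close>
    then show "q y \<le> 1 / measure lborel S"
      using Spos unfolding q_def by (cases "measure lborel ?D = 0") (auto simp: field_simps order_less_le)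
  qed
  \<comment> \<open>The inner integral is computed twice: in \<open>ennreal\<close> for Tonelli,
    which establishes integrability, and then in the reals for Fubini, which gives the mean.\<close>
  have inner: "(\<integral>\<^sup>+z. ennreal (simplex_kernel d (y(Suc d := z))) \<partial>P) = ennreal (q y)" for y :: "nat \<Rightarrow> 'a"
  proof -
    let ?D = "open_simplex (y ` {..d})"
    have "(\<integral>\<^sup>+z. ennreal (simplex_kernel d (y(Suc d := z))) \<partial>P)
        = (\<integral>\<^sup>+z. ennreal (1 / measure lborel ?D) * indicator ?D z \<partial>P)"
      by (intro nn_integral_cong) (simp add: simplex_kernel_def upd split: split_indicator)
    also have "\<dots> = ennreal (1 / measure lborel ?D) * emeasure P ?D"
      by (rule nn_integral_cmult_indicator) (simp add: \<open>sets P = sets borel\<close> sets_open_simplex)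
    also have "\<dots> = ennreal (q y)"
      by (simp add: P.emeasure_eq_measure q_def flip: ennreal_mult)
    finally show ?thesis .
  qed
  have inner': "(\<integral>z. simplex_kernel d (y(Suc d := z)) \<partial>P) = q y" for y :: "nat \<Rightarrow> 'a"
  proof -
    let ?D = "open_simplex (y ` {..d})"
    have "(\<integral>z. simplex_kernel d (y(Suc d := z)) \<partial>P) = (\<integral>z. indicator ?D z / measure lborel ?D \<partial>P)"
      by (simp add: simplex_kernel_def upd)
    also have "\<dots> = q y"
      by (simp add: q_def \<open>sets P = sets borel\<close> sets_open_simplex)
    finally show ?thesis .
  qed
  have int: "integrable (\<Pi>\<^sub>M i\<in>{..Suc d}. P) (simplex_kernel d)"
  proof (rule integrableI_nonneg)
    have "(\<integral>\<^sup>+y. ennreal (simplex_kernel d y) \<partial>(\<Pi>\<^sub>M i\<in>{..Suc d}. P))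
        = (\<integral>\<^sup>+y. (\<integral>\<^sup>+z. ennreal (simplex_kernel d (y(Suc d := z))) \<partial>P) \<partial>(\<Pi>\<^sub>M i\<in>{..d}. P))"
      unfolding ins(1) by (rule prod.product_nn_integral_insert) (use meas in \<open>auto simp: ins(1)\<close>)
    also have "\<dots> = (\<integral>\<^sup>+y. ennreal (q y) \<partial>(\<Pi>\<^sub>M i\<in>{..d}. P))"
      by (simp add: inner)
    also have "\<dots> \<le> (\<integral>\<^sup>+y. ennreal (1 / measure lborel S) \<partial>(\<Pi>\<^sub>M i\<in>{..d}. P))"
      by (intro nn_integral_mono ennreal_leI q)
    also have "\<dots> < \<infinity>"
      by (simp add: V.emeasure_space_1)
    finally show "(\<integral>\<^sup>+y. ennreal (simplex_kernel d y) \<partial>(\<Pi>\<^sub>M i\<in>{..Suc d}. P)) < \<infinity>" .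
  qed (auto simp: simplex_kernel_def)
  then show "integrable (\<Pi>\<^sub>M i\<in>{..Suc DIM('a)}. P) (simplex_kernel DIM('a))"
    by (simp add: d_def)
  have "(\<integral>y. simplex_kernel d y \<partial>(\<Pi>\<^sub>M i\<in>{..Suc d}. P))
      = (\<integral>y. (\<integral>z. simplex_kernel d (y(Suc d := z)) \<partial>P) \<partial>(\<Pi>\<^sub>M i\<in>{..d}. P))"
    unfolding ins(1) by (rule prod.product_integral_insert) (use int in \<open>auto simp: ins(1)\<close>)
  also have "\<dots> = (\<integral>y. (1 / measure lborel S) * (measure lebesgue (open_simplex (y ` {..d}) \<inter> S)
      / measure lebesgue (open_simplex (y ` {..d}))) \<partial>(\<Pi>\<^sub>M i\<in>{..d}. P))"
    unfolding inner' q_def measure_lebesgue_open_simplex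
    using S by (intro Bochner_Integration.integral_cong)
      (auto simp: P_simplex sets_open_simplex measure_completion)
  also have "\<dots> = (1 / measure lborel S) * (1 - nonconvexity S)"
    by (subst integral_mult_right_zero) (simp add: nonconvexity_def d_def P_def)
  finally show "nonconvexity S
      = 1 - measure lborel S * (\<integral>y. simplex_kernel DIM('a) y \<partial>(\<Pi>\<^sub>M i\<in>{..Suc DIM('a)}. P))"
    using Spos by (simp add: d_def field_simps)
qed



section \<open>Consistency for a uniform sample and a volume-consistent set estimator\<close>

theorem theorem4p4:
  fixes M :: "'m measure"
    and X :: "nat \<Rightarrow> 'm \<Rightarrow> 'a::euclidean_space"
    and S :: "'a set"
    and Sn :: "nat \<Rightarrow> (nat \<Rightarrow> 'a) \<Rightarrow> 'a set"
  assumes "compact S"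
    and "prob_space M"
    and "prob_space.indep_vars M (\<lambda>_. borel) X UNIV"
    and "\<And>i. distr M borel (X i) = uniform_measure lborel S"
    and "\<And>n \<omega>. \<omega> \<in> space M \<Longrightarrow> Sn n (\<lambda>i\<in>{..<n}. X i \<omega>) \<in> sets lebesgue"
    and "\<And>n. (\<lambda>\<omega>. measure lebesgue (Sn n (\<lambda>i\<in>{..<n}. X i \<omega>))) \<in> borel_measurable M"
    and "AE \<omega> in M. (\<lambda>n. d_mu S (Sn n (\<lambda>i\<in>{..<n}. X i \<omega>))) \<longlonglongrightarrow> 0"
  shows "converges_in_probability M
           (\<lambda>n \<omega>. nonconvexity_estimator n (\<lambda>i. X i \<omega>) (Sn n (\<lambda>i\<in>{..<n}. X i \<omega>)))
           (nonconvexity S)"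
proof -
  interpret prob_space M by fact
  note ind = assms(3) and law = assms(4)
  have rv [measurable]: "X i \<in> borel_measurable M" for i
    using ind by (auto simp: indep_vars_def)
  have S [measurable]: "S \<in> sets borel"
    using \<open>compact S\<close> by (rule borel_compact)
  have S_fin: "emeasure lborel S \<noteq> \<infinity>"
    using emeasure_bounded_finite[OF compact_imp_bounded[OF \<open>compact S\<close>]] by simp
  \<comment> \<open>If \<open>S\<close> were null, the density of
    \<open>uniform_measure lborel S\<close> would vanish almost everywhere, so this would be the
    zero measure and not the law of a random vector.\<close>
  have S_pos: "emeasure lborel S \<noteq> 0"
  proof
    assume "emeasure lborel S = 0"
    then have "AE x in lborel. x \<notin> S"
      by (intro AE_not_in) auto
    then have "(\<integral>\<^sup>+x. indicator S x / emeasure lborel S \<partial>lborel) = 0"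
      by (subst nn_integral_0_iff_AE) (auto elim: eventually_mono)
    then have "emeasure (distr M borel (X 0)) UNIV = 0"
      by (simp add: law uniform_measure_def emeasure_density)
    moreover have "emeasure (distr M borel (X 0)) UNIV = 1"
      by (subst emeasure_distr) (auto simp: emeasure_space_1)
    ultimately show False
      by simp
  qed
  define P where "P = uniform_measure lborel S"
  define d where "d = DIM('a)"
  define h where "h = (simplex_kernel d :: (nat \<Rightarrow> 'a) \<Rightarrow> real)"
  define \<theta> where "\<theta> = (\<integral>y. h y \<partial>(\<Pi>\<^sub>M i\<in>{..Suc d}. P))"
  have h: "integrable (\<Pi>\<^sub>M i\<in>{..Suc d}. P) h"
    unfolding h_def d_def P_def by (rule integrable_simplex_kernel[OF S S_pos S_fin])
  have law: "distr M borel (X i) = P" for i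
    by (simp add: law P_def)
  define T where "T n = pointed_subsets (Suc d) {..<n}" for n :: nat
  \<comment> \<open>Any enumeration of the vertices will do, since the kernel sees only their set.
    The tuple \<open>e t\<close> lists them at positions \<open>0\<close> to \<open>d\<close> and
    puts the tested index at \<open>Suc d\<close>.\<close>
  have "\<exists>b. bij_betw b {..d} I" if "finite I" "card I = Suc d" for I :: "nat set"
    using ex_bij_betw_nat_finite[OF that(1)] that(2) by (simp add: atLeast0LessThan lessThan_Suc_atMost)
  then obtain b where b: "\<And>I :: nat set. finite I \<Longrightarrow> card I = Suc d \<Longrightarrow> bij_betw (b I) {..d} I"
    by metis
  define e where "e t = (b (fst t))(Suc d := snd t)" for t :: "nat set \<times> nat"
  have T: "bij_betw (b (fst t)) {..d} (fst t)" "snd t \<notin> fst t" if "t \<in> T n" for t n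
    using that by (auto simp: T_def pointed_subsets_def intro!: b finite_subset[OF _ finite_lessThan])
  have e_vertices: "e t ` {..d} = fst t" if "t \<in> T n" for t n
    using T(1)[OF that] by (auto simp: e_def bij_betw_def)
  have e_last: "e t (Suc d) = snd t" for t
    by (simp add: e_def)
  have e_image: "e t ` {..Suc d} = insert (snd t) (fst t)" if "t \<in> T n" for t n
    using e_vertices[OF that] by (simp add: atMost_Suc e_last)
  have e_inj: "inj_on (e t) {..Suc d}" if "t \<in> T n" for t n
  proof -
    have "inj_on (e t) {..d}"
      using T(1)[OF that] by (auto simp: e_def bij_betw_def inj_on_def)
    moreover have "e t (Suc d) \<notin> e t ` {..d}"
      using T(2)[OF that] e_vertices[OF that] by (simp add: e_last)
    ultimately show ?thesis
      by (simp add: atMost_Suc)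
  qed
  have overlap: "real (card {u \<in> T n. e t ` {..Suc d} \<inter> e u ` {..Suc d} \<noteq> {}})
      \<le> (real (Suc (Suc d)))\<^sup>2 / n * card (T n)" if "t \<in> T n" for t n
  proof -
    have "{u \<in> T n. e t ` {..Suc d} \<inter> e u ` {..Suc d} \<noteq> {}}
        = {u \<in> T n. insert (snd t) (fst t) \<inter> insert (snd u) (fst u) \<noteq> {}}"
      using e_image[OF that] e_image by (intro Collect_cong conj_cong) simp_all
    then show ?thesis
      using card_overlapping_pointed_subsets_le[of "{..<n}" t "Suc d"] that by (simp add: T_def)
  qed
  define U where "U n \<omega> = (\<Sum>t\<in>T n. h (\<lambda>j\<in>{..Suc d}. X (e t j) \<omega>)) / card (T n)" for n \<omega>
  have "converges_in_probability M U \<theta>"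
  proof (rule converges_in_probability_L1)
    have "integrable M (\<lambda>\<omega>. h (\<lambda>j\<in>{..Suc d}. X (e t j) \<omega>))" if "t \<in> T n" for t n
      using integral_iid_reindex(2)[OF ind law e_inj[OF that]] h
      by (simp add: h_def borel_measurable_simplex_kernel)
    then show "integrable M (U n)" for n
      unfolding U_def by (intro integrable_divide Bochner_Integration.integrable_sum) auto
    \<comment> \<open>A pair uses \<open>d + 1\<close> vertices and one further index, so pairs
      exist from \<open>n = d + 2\<close> on.\<close>
    have "\<forall>\<^sub>F n in sequentially. T n \<noteq> {}"
    proof (rule eventually_sequentiallyI)
      fix n assume "Suc (Suc d) \<le> n"
      then have "card (T n) > 0"
        by (simp add: T_def card_pointed_subsets)
      then show "T n \<noteq> {}"
        by auto
    qed
    moreover have "(\<lambda>n. (real (Suc (Suc d)))\<^sup>2 / n) \<longlonglongrightarrow> 0"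
      by (rule lim_const_over_n)
    ultimately show "(\<lambda>n. \<integral>\<omega>. \<bar>U n \<omega> - \<theta>\<bar> \<partial>M) \<longlonglongrightarrow> 0"
      unfolding U_def \<theta>_def
      by (intro iid_averages_tendsto_L1[OF ind law h _ _ e_inj overlap]) (auto simp: T_def)
  qed
  moreover have "converges_in_probability M (\<lambda>n \<omega>. measure lebesgue (Sn n (\<lambda>i\<in>{..<n}. X i \<omega>))) (measure lebesgue S)"
  proof (rule converges_in_probability_AE)
    have "S \<in> lmeasurable"
      using \<open>compact S\<close> by (rule lmeasurable_compact)
    then show "AE \<omega> in M. (\<lambda>n. measure lebesgue (Sn n (\<lambda>i\<in>{..<n}. X i \<omega>))) \<longlonglongrightarrow> measure lebesgue S"
      by (intro AE_mp[OF assms(7) AE_I2] impI tendsto_measure_of_d_mu assms(5))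
  qed (rule assms(6))
  ultimately have lim: "converges_in_probability M
      (\<lambda>n \<omega>. measure lebesgue (Sn n (\<lambda>i\<in>{..<n}. X i \<omega>)) * U n \<omega>) (measure lebesgue S * \<theta>)"
    by (intro converges_in_probability_mult)
  have "emeasure P {x} = 0" for x
  proof -
    have "emeasure lborel (S \<inter> {x}) \<le> emeasure lborel {x}"
      by (intro emeasure_mono) auto
    then show ?thesis
      using S by (simp add: P_def)
  qed
  then have inj: "AE \<omega> in M. inj (\<lambda>i. X i \<omega>)"
    by (intro AE_iid_inj[OF ind law])
  \<comment> \<open>Only almost sure, because the estimator counts distinct points whereas
    \<open>U\<close> counts indices.\<close>
  have eq: "AE \<omega> in M. nonconvexity_estimator n (\<lambda>i. X i \<omega>) (Sn n (\<lambda>i\<in>{..<n}. X i \<omega>))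
      = 1 - measure lebesgue (Sn n (\<lambda>i\<in>{..<n}. X i \<omega>)) * U n \<omega>" for n
    using inj
  proof eventually_elim
    case (elim \<omega>)
    have kernel: "h (\<lambda>j\<in>{..Suc d}. X (e t j) \<omega>)
        = indicator (open_simplex ((\<lambda>i. X i \<omega>) ` fst t)) (X (snd t) \<omega>)
          / measure lborel (open_simplex ((\<lambda>i. X i \<omega>) ` fst t))" if "t \<in> T n" for t
    proof -
      have "(\<lambda>j\<in>{..Suc d}. X (e t j) \<omega>) ` {..d} = (\<lambda>i. X i \<omega>) ` fst t"
        unfolding e_vertices[OF that, symmetric] image_image by (intro image_cong) auto
      then show ?thesis
        by (simp add: h_def simplex_kernel_def e_last)
    qed
    have "U n \<omega> = (\<Sum>t\<in>T n. indicator (open_simplex ((\<lambda>i. X i \<omega>) ` fst t)) (X (snd t) \<omega>)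
          / measure lborel (open_simplex ((\<lambda>i. X i \<omega>) ` fst t))) / card (T n)"
      unfolding U_def by (simp add: kernel cong: sum.cong)
    then show ?case
      using nonconvexity_estimator_eq[OF inj_on_subset[OF elim subset_UNIV], of n]
      by (simp add: T_def d_def)
  qed
  have "converges_in_probability M
      (\<lambda>n \<omega>. nonconvexity_estimator n (\<lambda>i. X i \<omega>) (Sn n (\<lambda>i\<in>{..<n}. X i \<omega>)))
      (1 - measure lebesgue S * \<theta>)"
    by (rule converges_in_probability_1_minus_AE[OF _ lim eq])
       (intro borel_measurable_nonconvexity_estimator rv assms(6))
  also have "1 - measure lebesgue S * \<theta> = nonconvexity S"
    using nonconvexity_eq_integral_simplex_kernel[OF S S_pos S_fin] S
    by (simp add: \<theta>_def h_def d_def P_def measure_completion)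
  finally show ?thesis .
qed

end
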